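(* Let $(H,d)$ be a Hadamard space and $x\in H$. The topological spaces $(\Gamma_x(H),\tau_{w_\Gamma})$ and $(H,\tau_w)$ are homeomorphic.
   Context: A Hadamard space is a complete $\mathrm{CAT}(0)$ space. For $x\in H$, $\Gamma_x(H)$ is the set of all constant speed geodesics $\gamma:[0,1]\to H$ (i.e. $d(\gamma(s),\gamma(t))=|s-t|\,d(\gamma(0),\gamma(1))$ for all $s,t\in[0,1]$) with $\gamma(0)=x$. For a geodesic $\gamma$, $P_\gamma$ denotes the metric projection onto (the image of) $\gamma$. Weak topology $\tau_w$ on $H$: a set $U\subset H$ is weakly open if for every $y\in U$ there exist $\varepsilon>0$ and finitely many $\gamma_1,\dots,\gamma_n\in\Gamma_y(H)$ with $\{z\in H: d(y,P_{\gamma_i}z)<\varepsilon,\ i=1,\dots,n\}\subseteq U$. The weakly open sets (together with $\emptyset$) form the topology $\tau_w$. Weak-$\Gamma$ topology $\tau_{w_\Gamma}$ on $\Gamma_x(H)$: a set $U\subseteq\Gamma_x(H)$ is weak-$\Gamma$ open if for every $\gamma\in U$ there exist $\varepsilon>0$ and finitely many geodesics $\gamma_1,\dots,\gamma_n\in\Gamma_{\gamma(1)}(H)$ such that $$\{\eta\in\Gamma_x(H): d(\gamma(1),P_{\gamma_i}\eta(1))<\varepsilon,\ i=1,\dots,n\}\subseteq U.$$ The weak-$\Gamma$ open sets form the topology $\tau_{w_\Gamma}$. *)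

theory Defs
  imports "HOL-Analysis.Analysis"
begin

context Metric_space
begin

text \<open>Geodesics are functions on the unit interval, hence extensional outside it; otherwise
  a single geodesic would be represented by many elements of type \<^typ>\<open>real \<Rightarrow> 'a\<close>.\<close>

definition geodesic :: "(real \<Rightarrow> 'a) \<Rightarrow> bool" where
  "geodesic \<gamma> \<longleftrightarrow> \<gamma> \<in> {0..1} \<rightarrow>\<^sub>E M \<and>
     (\<forall>s\<in>{0..1}. \<forall>t\<in>{0..1}. d (\<gamma> s) (\<gamma> t) = \<bar>s - t\<bar> * d (\<gamma> 0) (\<gamma> 1))"

definition geodesics_from :: "'a \<Rightarrow> (real \<Rightarrow> 'a) set" where
  "geodesics_from x = {\<gamma>. geodesic \<gamma> \<and> \<gamma> 0 = x}"

definition metric_proj :: "'a set \<Rightarrow> 'a \<Rightarrow> 'a" where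
  "metric_proj C z = (THE p. p \<in> C \<and> (\<forall>q\<in>C. d z p \<le> d z q))"

abbreviation geodesic_proj :: "(real \<Rightarrow> 'a) \<Rightarrow> 'a \<Rightarrow> 'a" where
  "geodesic_proj \<gamma> \<equiv> metric_proj (\<gamma> ` {0..1})"

definition weakly_open :: "'a set \<Rightarrow> bool" where
  "weakly_open U \<longleftrightarrow> U \<subseteq> M \<and>
     (\<forall>y\<in>U. \<exists>\<epsilon>>0. \<exists>F. finite F \<and> F \<subseteq> geodesics_from y \<and>
        {z \<in> M. \<forall>\<gamma>\<in>F. d y (geodesic_proj \<gamma> z) < \<epsilon>} \<subseteq> U)"

definition weak_topology :: "'a topology" where
  "weak_topology = topology weakly_open"

definition weakly_Gamma_open :: "'a \<Rightarrow> (real \<Rightarrow> 'a) set \<Rightarrow> bool" where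
  "weakly_Gamma_open x U \<longleftrightarrow> U \<subseteq> geodesics_from x \<and>
     (\<forall>\<gamma>\<in>U. \<exists>\<epsilon>>0. \<exists>F. finite F \<and> F \<subseteq> geodesics_from (\<gamma> 1) \<and>
        {\<eta> \<in> geodesics_from x. \<forall>\<sigma>\<in>F. d (\<gamma> 1) (geodesic_proj \<sigma> (\<eta> 1)) < \<epsilon>} \<subseteq> U)"

definition weak_Gamma_topology :: "'a \<Rightarrow> (real \<Rightarrow> 'a) topology" where
  "weak_Gamma_topology x = topology (weakly_Gamma_open x)"

lemma istopology_weakly_open: "istopology weakly_open"
  unfolding istopology_def
proof (intro conjI allI impI)
  fix S T assume S: "weakly_open S" and T: "weakly_open T"
  show "weakly_open (S \<inter> T)"
    unfolding weakly_open_def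
  proof (intro conjI ballI)
    show "S \<inter> T \<subseteq> M" using S by (auto simp: weakly_open_def)
    fix y assume y: "y \<in> S \<inter> T"
    obtain e F where 1: "e > 0" "finite F" "F \<subseteq> geodesics_from y"
        "{z \<in> M. \<forall>\<gamma>\<in>F. d y (geodesic_proj \<gamma> z) < e} \<subseteq> S"
      using S y unfolding weakly_open_def by blast
    obtain e' F' where 2: "e' > 0" "finite F'" "F' \<subseteq> geodesics_from y"
        "{z \<in> M. \<forall>\<gamma>\<in>F'. d y (geodesic_proj \<gamma> z) < e'} \<subseteq> T"
      using T y unfolding weakly_open_def by blast
    show "\<exists>\<epsilon>>0. \<exists>F. finite F \<and> F \<subseteq> geodesics_from y \<and>
        {z \<in> M. \<forall>\<gamma>\<in>F. d y (geodesic_proj \<gamma> z) < \<epsilon>} \<subseteq> S \<inter> T"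
      using 1 2 by (intro exI[of _ "min e e'"] exI[of _ "F \<union> F'"] conjI) auto
  qed
next
  fix \<K> assume K: "\<forall>K\<in>\<K>. weakly_open K"
  show "weakly_open (\<Union> \<K>)"
    unfolding weakly_open_def
  proof (intro conjI ballI)
    show "\<Union> \<K> \<subseteq> M" using K by (auto simp: weakly_open_def)
    fix y assume "y \<in> \<Union> \<K>"
    then obtain K where KK: "K \<in> \<K>" "y \<in> K" by blast
    then have "weakly_open K" using K by blast
    then obtain e F where 1: "e > 0" "finite F" "F \<subseteq> geodesics_from y"
        "{z \<in> M. \<forall>\<gamma>\<in>F. d y (geodesic_proj \<gamma> z) < e} \<subseteq> K"
      using KK(2) unfolding weakly_open_def by blast
    have "K \<subseteq> \<Union> \<K>" using KK(1) by blast
    with 1 show "\<exists>\<epsilon>>0. \<exists>F. finite F \<and> F \<subseteq> geodesics_from y \<and>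
        {z \<in> M. \<forall>\<gamma>\<in>F. d y (geodesic_proj \<gamma> z) < \<epsilon>} \<subseteq> \<Union> \<K>"
      by (intro exI[of _ e] exI[of _ F] conjI) (assumption | erule subset_trans)+
  qed
qed

lemma istopology_weakly_Gamma_open: "istopology (weakly_Gamma_open x)"
  unfolding istopology_def
proof (intro conjI allI impI)
  fix S T assume S: "weakly_Gamma_open x S" and T: "weakly_Gamma_open x T"
  show "weakly_Gamma_open x (S \<inter> T)"
    unfolding weakly_Gamma_open_def
  proof (intro conjI ballI)
    show "S \<inter> T \<subseteq> geodesics_from x" using S by (auto simp: weakly_Gamma_open_def)
    fix \<gamma> assume y: "\<gamma> \<in> S \<inter> T"
    obtain e F where 1: "e > 0" "finite F" "F \<subseteq> geodesics_from (\<gamma> 1)"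
        "{\<eta> \<in> geodesics_from x. \<forall>\<sigma>\<in>F. d (\<gamma> 1) (geodesic_proj \<sigma> (\<eta> 1)) < e} \<subseteq> S"
      using S y unfolding weakly_Gamma_open_def by blast
    obtain e' F' where 2: "e' > 0" "finite F'" "F' \<subseteq> geodesics_from (\<gamma> 1)"
        "{\<eta> \<in> geodesics_from x. \<forall>\<sigma>\<in>F'. d (\<gamma> 1) (geodesic_proj \<sigma> (\<eta> 1)) < e'} \<subseteq> T"
      using T y unfolding weakly_Gamma_open_def by blast
    show "\<exists>\<epsilon>>0. \<exists>F. finite F \<and> F \<subseteq> geodesics_from (\<gamma> 1) \<and>
        {\<eta> \<in> geodesics_from x. \<forall>\<sigma>\<in>F. d (\<gamma> 1) (geodesic_proj \<sigma> (\<eta> 1)) < \<epsilon>} \<subseteq> S \<inter> T"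
      using 1 2 by (intro exI[of _ "min e e'"] exI[of _ "F \<union> F'"] conjI) auto
  qed
next
  fix \<K> assume K: "\<forall>K\<in>\<K>. weakly_Gamma_open x K"
  show "weakly_Gamma_open x (\<Union> \<K>)"
    unfolding weakly_Gamma_open_def
  proof (intro conjI ballI)
    show "\<Union> \<K> \<subseteq> geodesics_from x" using K by (auto simp: weakly_Gamma_open_def)
    fix \<gamma> assume "\<gamma> \<in> \<Union> \<K>"
    then obtain K where KK: "K \<in> \<K>" "\<gamma> \<in> K" by blast
    then have "weakly_Gamma_open x K" using K by blast
    then obtain e F where 1: "e > 0" "finite F" "F \<subseteq> geodesics_from (\<gamma> 1)"
        "{\<eta> \<in> geodesics_from x. \<forall>\<sigma>\<in>F. d (\<gamma> 1) (geodesic_proj \<sigma> (\<eta> 1)) < e} \<subseteq> K"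
      using KK(2) unfolding weakly_Gamma_open_def by blast
    have "K \<subseteq> \<Union> \<K>" using KK(1) by blast
    with 1 show "\<exists>\<epsilon>>0. \<exists>F. finite F \<and> F \<subseteq> geodesics_from (\<gamma> 1) \<and>
        {\<eta> \<in> geodesics_from x. \<forall>\<sigma>\<in>F. d (\<gamma> 1) (geodesic_proj \<sigma> (\<eta> 1)) < \<epsilon>} \<subseteq> \<Union> \<K>"
      by (intro exI[of _ e] exI[of _ F] conjI) (assumption | erule subset_trans)+
  qed
qed

lemma openin_weak_topology: "openin weak_topology U \<longleftrightarrow> weakly_open U"
  by (simp add: weak_topology_def istopology_weakly_open)

lemma openin_weak_Gamma_topology:
  "openin (weak_Gamma_topology x) U \<longleftrightarrow> weakly_Gamma_open x U"
  by (simp add: weak_Gamma_topology_def istopology_weakly_Gamma_open)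

lemma topspace_weak_topology: "topspace weak_topology = M"
proof
  have "weakly_open (topspace weak_topology)"
    using openin_topspace openin_weak_topology by blast
  then show "topspace weak_topology \<subseteq> M"
    by (simp add: weakly_open_def)
  have "weakly_open M"
    unfolding weakly_open_def by (intro conjI ballI exI[of _ 1] exI[of _ "{}"]) auto
  then show "M \<subseteq> topspace weak_topology"
    by (simp add: openin_subset openin_weak_topology)
qed

lemma topspace_weak_Gamma_topology: "topspace (weak_Gamma_topology x) = geodesics_from x"
proof
  have "weakly_Gamma_open x (topspace (weak_Gamma_topology x))"
    using openin_topspace openin_weak_Gamma_topology by blast
  then show "topspace (weak_Gamma_topology x) \<subseteq> geodesics_from x"
    by (simp add: weakly_Gamma_open_def)
  have "weakly_Gamma_open x (geodesics_from x)"
    unfolding weakly_Gamma_open_def by (intro conjI ballI exI[of _ 1] exI[of _ "{}"]) auto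
  then show "geodesics_from x \<subseteq> topspace (weak_Gamma_topology x)"
    by (simp add: openin_subset openin_weak_Gamma_topology)
qed

end

text \<open>Comparison inequality for geodesic triangles: \<open>p'\<close>, \<open>q'\<close>, \<open>r'\<close> are the vertices of a
  comparison triangle in the Euclidean plane. The vertices and sides being arbitrary, points
  on any two distinct sides of a triangle are covered by taking \<open>p\<close> to be the common vertex;
  for points on one and the same side the inequality is an equality. The third side
  exists by \<open>ex_geodesic\<close> and does not occur in the inequality.\<close>

locale CAT0_space = Metric_space +
  assumes ex_geodesic:
      "\<lbrakk>p \<in> M; q \<in> M\<rbrakk> \<Longrightarrow> \<exists>\<gamma>. geodesic \<gamma> \<and> \<gamma> 0 = p \<and> \<gamma> 1 = q"
    and CAT0_inequality:
      "\<And>p q r \<gamma> \<eta> s t. \<And>p' q' r' :: real ^ 2.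
        \<lbrakk>geodesic \<gamma>; \<gamma> 0 = p; \<gamma> 1 = q; geodesic \<eta>; \<eta> 0 = p; \<eta> 1 = r;
         dist p' q' = d p q; dist p' r' = d p r; dist q' r' = d q r;
         s \<in> {0..1}; t \<in> {0..1}\<rbrakk>
        \<Longrightarrow> d (\<gamma> s) (\<eta> t) \<le> dist ((1 - s) *\<^sub>R p' + s *\<^sub>R q') ((1 - t) *\<^sub>R p' + t *\<^sub>R r')"

locale Hadamard_space = CAT0_space +
  assumes complete: mcomplete

end

theory Submission
  imports Defs
begin

text \<open>In a \<open>CAT(0)\<close> space two points are joined by exactly one geodesic, so the endpoint map
  \<open>\<gamma> \<mapsto> \<gamma> 1\<close> is a bijection from the geodesics starting at \<open>x\<close> onto the space
  (\<open>bij_betw_endpoint\<close>). A basic neighbourhood of \<open>\<gamma>\<close> constrains a geodesic \<open>\<eta>\<close> only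
  through \<open>\<eta> 1\<close>, and it does so by the very inequalities that define a basic weak
  neighbourhood of \<open>\<gamma> 1\<close>. Hence the weak-\<open>\<Gamma>\<close> topology is the weak topology transported along
  the endpoint map, and the endpoint map is a homeomorphism.\<close>

context Metric_space
begin

lemma geodesic_in_space: "geodesic \<gamma> \<Longrightarrow> s \<in> {0..1} \<Longrightarrow> \<gamma> s \<in> M"
  unfolding geodesic_def by (blast dest: PiE_mem)

lemma endpoint_in_space: "\<gamma> \<in> geodesics_from x \<Longrightarrow> \<gamma> 1 \<in> M"
  by (simp add: geodesics_from_def geodesic_in_space)

end

context CAT0_space
begin

text \<open>Two geodesics with the same endpoints form a triangle with a side of length zero. Its
  comparison triangle is a segment, so points with equal parameter have the same comparison
  point and therefore distance zero.\<close>

lemma geodesic_unique: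
  assumes g: "geodesic \<gamma>" and h: "geodesic \<eta>"
    and start: "\<gamma> 0 = \<eta> 0" and finish: "\<gamma> 1 = \<eta> 1"
  shows "\<gamma> = \<eta>"
proof (rule PiE_ext)
  show "\<gamma> \<in> {0..1} \<rightarrow>\<^sub>E M" "\<eta> \<in> {0..1} \<rightarrow>\<^sub>E M"
    using g h by (simp_all add: geodesic_def)
  fix s :: real
  assume s: "s \<in> {0..1}"
  let ?q = "d (\<gamma> 0) (\<gamma> 1) *\<^sub>R axis 1 1 :: real ^ 2"
  have "\<gamma> 1 \<in> M"
    using g by (simp add: geodesic_in_space)
  then have "d (\<gamma> s) (\<eta> s) \<le> dist ((1 - s) *\<^sub>R 0 + s *\<^sub>R ?q) ((1 - s) *\<^sub>R 0 + s *\<^sub>R ?q)"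
    using g h s start finish
    by (intro CAT0_inequality[of \<gamma> "\<gamma> 0" "\<gamma> 1" \<eta> "\<gamma> 1"]) (simp_all)
  then show "\<gamma> s = \<eta> s"
    using g h s geodesic_in_space by (metis dist_self nonneg order_antisym zero)
qed

lemma bij_betw_endpoint:
  assumes "x \<in> M"
  shows "bij_betw (\<lambda>\<gamma>. \<gamma> 1) (geodesics_from x) M"
proof (rule bij_betw_imageI)
  show "inj_on (\<lambda>\<gamma>. \<gamma> 1) (geodesics_from x)"
    by (auto intro!: inj_onI geodesic_unique simp: geodesics_from_def)
  show "(\<lambda>\<gamma>. \<gamma> 1) ` geodesics_from x = M"
  proof
    show "(\<lambda>\<gamma>. \<gamma> 1) ` geodesics_from x \<subseteq> M"
      by (auto simp: endpoint_in_space)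
    show "M \<subseteq> (\<lambda>\<gamma>. \<gamma> 1) ` geodesics_from x"
      using ex_geodesic[OF assms] by (fastforce simp: geodesics_from_def)
  qed
qed

text \<open>Since every point of the space is an endpoint, the neighbourhood condition at each point
  of \<open>U\<close> is one of the conditions at the geodesics ending in \<open>U\<close>, and the inclusion of a
  basic neighbourhood can be tested on endpoints.\<close>

lemma weakly_Gamma_open_endpoint_vimage:
  assumes "x \<in> M" and "U \<subseteq> M"
  shows "weakly_Gamma_open x {\<gamma> \<in> geodesics_from x. \<gamma> 1 \<in> U} \<longleftrightarrow> weakly_open U"
proof -
  have image: "(\<lambda>\<gamma>. \<gamma> 1) ` geodesics_from x = M"
    using bij_betw_endpoint[OF assms(1)] by (rule bij_betw_imp_surj_on)
  have endpoint_all: "(\<forall>\<gamma>\<in>geodesics_from x. P (\<gamma> 1)) \<longleftrightarrow> (\<forall>y\<in>M. P y)" for P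
    using image by (metis (no_types, lifting) imageE imageI)
  have neighbourhood:
    "{\<eta> \<in> geodesics_from x. Q (\<eta> 1)} \<subseteq> {\<gamma> \<in> geodesics_from x. \<gamma> 1 \<in> U}
      \<longleftrightarrow> {z \<in> M. Q z} \<subseteq> U" for Q
    using endpoint_all[of "\<lambda>z. Q z \<longrightarrow> z \<in> U"] by blast
  have restrict: "(\<forall>y\<in>M. y \<in> U \<longrightarrow> P y) \<longleftrightarrow> (\<forall>y\<in>U. P y)" for P
    using assms(2) by blast
  let ?N = "\<lambda>y. \<exists>\<epsilon>>0. \<exists>F. finite F \<and> F \<subseteq> geodesics_from y \<and>
        {z \<in> M. \<forall>\<sigma>\<in>F. d y (geodesic_proj \<sigma> z) < \<epsilon>} \<subseteq> U"
  have "weakly_Gamma_open x {\<gamma> \<in> geodesics_from x. \<gamma> 1 \<in> U}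
      \<longleftrightarrow> (\<forall>\<gamma>\<in>geodesics_from x. \<gamma> 1 \<in> U \<longrightarrow> ?N (\<gamma> 1))"
    unfolding weakly_Gamma_open_def
      neighbourhood[of "\<lambda>z. \<forall>\<sigma>\<in>F. d y (geodesic_proj \<sigma> z) < \<epsilon>" for F y \<epsilon>]
    by auto
  also have "\<dots> \<longleftrightarrow> (\<forall>y\<in>M. y \<in> U \<longrightarrow> ?N y)"
    by (rule endpoint_all[of "\<lambda>y. y \<in> U \<longrightarrow> ?N y"])
  also have "\<dots> \<longleftrightarrow> weakly_open U"
    unfolding weakly_open_def restrict by (simp only: assms(2) simp_thms)
  finally show ?thesis .
qed

lemma homeomorphic_map_endpoint:
  assumes "x \<in> M"
  shows "homeomorphic_map (weak_Gamma_topology x) weak_topology (\<lambda>\<gamma>. \<gamma> 1)"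
  using bij_betw_endpoint[OF assms] weakly_Gamma_open_endpoint_vimage[OF assms]
  by (simp add: homeomorphic_map_def quotient_map_def bij_betw_def openin_weak_topology
      openin_weak_Gamma_topology topspace_weak_topology topspace_weak_Gamma_topology)

end

theorem proposition14:
  fixes H :: "'a set" and d :: "'a \<Rightarrow> 'a \<Rightarrow> real" and x :: 'a
  assumes "Hadamard_space H d"
    and "x \<in> H"
  shows "Metric_space.weak_Gamma_topology H d x homeomorphic_space Metric_space.weak_topology H d"
proof -
  interpret Hadamard_space H d
    by (fact assms(1))
  show ?thesis
    using homeomorphic_map_endpoint[OF assms(2)] by (rule homeomorphic_map_imp_homeomorphic_space)
qed

end
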